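(* The following statements hold. (i) Let $m\ge4$ be an integer and $0<a<\frac{m-3}{2}$. Then the bound "for every $\varepsilon>0$, $\mathcal B_m(x,M)\ll_{\varepsilon,m}(Mx)^\varepsilon$" fails along a sequence with $x_N\asymp N^a$. That is, for all sufficiently large integers $N$ there exist $x_N>0$, an integer $1\le H_N<N/2$ and $M_N\in\{N-H_N,N\}$, with $x_N\asymp N^a$, such that for some $\varepsilon>0$ there is no constant $C$ with $|\mathcal B_m(x_N,M_N)|\le C\,(M_Nx_N)^{\varepsilon}$ for all sufficiently large $N$. (ii) Let $m\ge6$ be an integer and $\lambda>1$. Then for all sufficiently large integers $N$ there exist $x_N>0$, an integer $1\le H_N<N/2$ and $M_N\in\{N-H_N,N\}$ with $$x_N=\lambda N\left(1+O_{m,\lambda}(N^{-2/m})\right),\qquad H_N\asymp_{m,\lambda}N^{1-2/m},\qquad 1\le N-H_N<N\le x_N,$$ and $$|\mathcal B_m(x_N,M_N)|\gg_{m,\lambda}N^{(m-5)/(2m)}.$$ Thus the bound "for every $\varepsilon>0$, $\mathcal B_m(x,M)\ll_{\varepsilon,m}(Mx)^\varepsilon$" fails even when restricted to the range $1\le M\le x$. (iii) Let $m\ge5$ be an integer and put $a=\frac{2}{m-1}$. Then for all sufficiently large integers $N$ there exist $x_N>0$, an integer $1\le H_N<N/2$ and $M_N\in\{N-H_N,N\}$ with $$x_N=N^{a}\left(1+O_{m}(N^{-(a+1)/m})\right),\qquad H_N\asymp_{m}N^{1-(a+1)/m},$$ so that $N=x_N^{(m-1)/2}(1+o(1))$ as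 $N\to\infty$, and $$|\mathcal B_m(x_N,M_N)|\gg_m N^{\frac{m^2-4m-1}{2m(m-1)}}.$$ Moreover, for integers $m\ge2$, the exponent $\frac{m^2-4m-1}{2m(m-1)}$ is positive precisely when $m\ge5$.
   Context: For an integer $m\ge2$, let $d_m(n):=\#\{(n_1,\ldots,n_m)\in\mathbb N^m: n_1\cdots n_m=n\}$ with $\mathbb N=\{1,2,\ldots\}$ (the Dirichlet coefficients of $\zeta(s)^m$), let $\beta_m:=\frac{m+1}{2m}$ and $\phi_m:=\frac{\pi(m-3)}{4}$. For $x>0$ and a positive integer $M$ define $$\mathcal B_m(x,M):=\sum_{n\le M}d_m(n)\,n^{-\beta_m}\cos\!\left(2\pi m(nx)^{1/m}+\phi_m\right),$$ the sum being over positive integers $n\le M$. This is the Friedlander–Iwaniec sharply truncated dual sum for $A(s)=B(s)=\zeta(s)^m$ (conductor $D=1$), and the bound "for every $\varepsilon>0$, $\mathcal B_m(x,M)\ll_{\varepsilon,m}(Mx)^\varepsilon$", uniformly in $x$ and $M$, is the prediction of Friedlander–Iwaniec's Conjecture 1 for this datum. The notation $F\ll_{\mathcal P}G$, equivalently $F=O_{\mathcal P}(G)$, means $|F|\le C G$ with a constant $C$ depending only on the parameters $\mathcal P$ (so uniformly in $N$); $G\gg_{\mathcal P}F$ means $F\ll_{\mathcal P}G$, and $F\asymp_{\mathcal P}G$ means both $F\ll_{\mathcal P}G$ and $G\ll_{\mathcal P}F$. In $x_N\asymp N^a$ the constants may depend on the fixed parameters $m$ and $a$. *)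

theory Defs
  imports "HOL-Analysis.Analysis" "HOL-Library.Landau_Symbols"
begin

text \<open>Ordered factorisations of \<open>n\<close> into \<open>m\<close> positive factors, encoded as lists of length \<open>m\<close>.\<close>

definition div_count :: "nat \<Rightarrow> nat \<Rightarrow> nat" where
  "div_count m n = card {ns :: nat list. length ns = m \<and> (\<forall>k\<in>set ns. 1 \<le> k) \<and> prod_list ns = n}"

definition fi_beta :: "nat \<Rightarrow> real" where
  "fi_beta m = (real m + 1) / (2 * real m)"

definition fi_phi :: "nat \<Rightarrow> real" where
  "fi_phi m = pi * (real m - 3) / 4"

text \<open>The Friedlander--Iwaniec sharply truncated dual sum for \<open>\<zeta>(s)\<^sup>m\<close> in both
  factors (conductor 1).\<close>

definition dual_sum :: "nat \<Rightarrow> real \<Rightarrow> nat \<Rightarrow> real" where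
  "dual_sum m x M =
     (\<Sum>n = 1..M. real (div_count m n) * real n powr (- fi_beta m)
        * cos (2 * pi * real m * (real n * x) powr (1 / real m) + fi_phi m))"

end

theory Submission
  imports Defs "HOL-Real_Asymp.Real_Asymp"
begin

text \<open>On a block \<open>N - H < n \<le> N\<close> with \<open>H\<close> a small multiple of \<open>N / (N x)\<^sup>1\<^sup>/\<^sup>m\<close>, the phase
  \<open>2 \<pi> m (n x)\<^sup>1\<^sup>/\<^sup>m\<close> varies by at most \<open>\<pi> / 3\<close>. A relative perturbation of \<open>x\<close> of size
  \<open>O((N x)\<^sup>-\<^sup>1\<^sup>/\<^sup>m)\<close> makes the full phase at \<open>n = N\<close> a multiple of \<open>2 \<pi>\<close>, so every cosine on the block
  is at least \<open>1 / 2\<close>. As \<open>d\<^sub>m(n) \<ge> 1\<close>, the sums truncated at \<open>N\<close> and at \<open>N - H\<close> differ by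
  \<open>\<gg> H N\<^sup>-\<^sup>\<beta>\<close>, so one of the two is at least half of that.\<close>

section \<open>Coherence of the dual sum on one short block\<close>

lemma div_count_ge_1:
  assumes "1 \<le> m" "1 \<le> n"
  shows "1 \<le> div_count m n"
proof -
  let ?S = "{ns :: nat list. length ns = m \<and> (\<forall>k\<in>set ns. 1 \<le> k) \<and> prod_list ns = n}"
  have dvd: "k dvd prod_list ns" if "k \<in> set ns" for k :: nat and ns
    using that by (induction ns) auto
  \<comment> \<open>\<open>card\<close> is 0 on an infinite set, so finiteness must precede the
    witness \<open>n\<close>, 1, ..., 1. Each factor divides \<open>n > 0\<close>, hence is at most
    \<open>n\<close>.\<close>
  have "?S \<subseteq> {ns. set ns \<subseteq> {..n} \<and> length ns = m}"
    using dvd assms(2) by (auto intro!: dvd_imp_le)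
  moreover have "finite {ns. set ns \<subseteq> {..n} \<and> length ns = m}"
    by (intro finite_lists_length_eq) auto
  ultimately have "finite ?S"
    by (rule finite_subset)
  moreover have "prod_list (replicate k (1::nat)) = 1" for k
    by (induction k) auto
  then have "n # replicate (m - 1) 1 \<in> ?S"
    using assms by auto
  then have "?S \<noteq> {}" by blast
  ultimately have "card ?S > 0"
    by (subst card_gt_0_iff) blast
  then show ?thesis
    unfolding div_count_def by linarith
qed

text \<open>Writing \<open>x\<close> as \<open>u ^ m / N\<close> makes \<open>u\<close> the m-th
  root of \<open>N * x\<close>, so \<open>phase\<close> says that 2 pi divides the full phase at
  \<open>n = N\<close>. The factor 6 in \<open>short\<close> caps the drift 2 pi m u H / N over the
  block at pi / 3, where the cosine is 1 / 2.\<close>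

lemma dual_sum_block_lower:
  fixes u :: real
  assumes m: "1 \<le> m" and N: "0 < N" and H: "H < N" and u: "0 \<le> u"
    and phase: "real m * u + fi_phi m / (2 * pi) \<in> \<int>"
    and short: "6 * real m * u * real H \<le> real N"
  shows "real H * real N powr (- fi_beta m) / 2
     \<le> dual_sum m (u ^ m / real N) N - dual_sum m (u ^ m / real N) (N - H)"
proof -
  let ?x = "u ^ m / real N"
  let ?t = "\<lambda>n. real (div_count m n) * real n powr (- fi_beta m)
        * cos (2 * pi * real m * (real n * ?x) powr (1 / real m) + fi_phi m)"
  have split: "{1..N} = {1..N - H} \<union> {N - H<..N}" "{1..N - H} \<inter> {N - H<..N} = {}"
    using H by auto
  have eq: "dual_sum m ?x N - dual_sum m ?x (N - H) = (\<Sum>n\<in>{N - H<..N}. ?t n)"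
    unfolding dual_sum_def by (subst split(1), subst sum.union_disjoint) (use split in auto)
  have "real N powr (- fi_beta m) / 2 \<le> ?t n" if n: "n \<in> {N - H<..N}" for n
  proof -
    define q where "q = (real n / real N) powr (1 / real m)"
    have n1: "1 \<le> n" "n \<le> N" using n by auto
    have r01: "0 < real n / real N" "real n / real N \<le> 1" using n1 N by auto
    \<comment> \<open>A base in (0, 1] only grows when the exponent drops from 1 to
      \<open>1 / m\<close>. This gives the linear bound \<open>1 - q \<le> H / N\<close> without
      differentiating the root.\<close>
    have "(real n / real N) powr 1 \<le> q"
      unfolding q_def using r01 m by (intro powr_mono') auto
    moreover have "real N - real H \<le> real n" using n H by auto
    then have "(real N - real H) / real N \<le> real n / real N"
      by (rule divide_right_mono) simp
    then have "1 - real H / real N \<le> real n / real N"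
      using N by (simp add: diff_divide_distrib)
    ultimately have q_ge: "1 - q \<le> real H / real N" using r01 by simp
    have q_le: "q \<le> 1" unfolding q_def using r01 by (intro powr_le1) auto
    have "(real n * ?x) powr (1 / real m) = (real n / real N * u ^ m) powr (1 / real m)"
      by simp
    also have "\<dots> = q * (u ^ m) powr (1 / real m)"
      unfolding q_def using r01 u by (subst powr_mult) auto
    also have "(u ^ m) powr (1 / real m) = u"
      using u m by (cases "u = 0") (auto simp: powr_powr simp flip: powr_realpow)
    finally have root: "(real n * ?x) powr (1 / real m) = q * u" .
    obtain k :: int where k: "real m * u + fi_phi m / (2 * pi) = of_int k"
      using phase by (auto elim: Ints_cases)
    \<comment> \<open>The amount by which the phase at \<open>n\<close> falls short of the phase at
      \<open>N\<close>; modulo 2 pi and up to sign it is the whole argument of the cosine.\<close>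
    define \<theta> where "\<theta> = 2 * pi * real m * u * (1 - q)"
    have "2 * pi * real m * (q * u) + fi_phi m
        = 2 * pi * (real m * u + fi_phi m / (2 * pi)) - \<theta>"
      unfolding \<theta>_def by (simp add: field_simps)
    also have "\<dots> = 2 * pi * of_int k - \<theta>" by (simp only: k)
    finally have "cos (2 * pi * real m * (real n * ?x) powr (1 / real m) + fi_phi m)
        = cos (2 * pi * of_int k - \<theta>)"
      by (simp only: root)
    also have "\<dots> = cos \<theta>"
      by (simp add: cos_diff)
    finally have cos_eq: "cos (2 * pi * real m * (real n * ?x) powr (1 / real m) + fi_phi m) = cos \<theta>" .
    have "0 \<le> \<theta>" unfolding \<theta>_def using u q_le by simp
    moreover have "\<theta> \<le> pi / 3"
    proof -
      have "\<theta> \<le> 2 * pi * real m * u * (real H / real N)"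
        unfolding \<theta>_def using q_ge u by (intro mult_left_mono) auto
      also have "\<dots> = pi / 3 * (6 * real m * u * real H / real N)" by simp
      also have "\<dots> \<le> pi / 3 * 1"
        using short N by (intro mult_left_mono) auto
      finally show ?thesis by simp
    qed
    ultimately have "cos (pi / 3) \<le> cos \<theta>"
      by (intro cos_monotone_0_pi_le) auto
    then have cos_ge: "1 / 2 \<le> cos \<theta>" by (simp add: cos_60)
    \<comment> \<open>The weight decreases in \<open>n\<close>, so the right end of the block bounds
      all weights from below.\<close>
    have "real N powr (- fi_beta m) \<le> real n powr (- fi_beta m)"
      using n1 m unfolding fi_beta_def by (intro powr_mono2') auto
    moreover have "1 \<le> real (div_count m n)"
      using div_count_ge_1[OF m n1(1)] by simp
    ultimately have "1 * real N powr (- fi_beta m) * (1 / 2) \<le>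
        real (div_count m n) * real n powr (- fi_beta m) * cos \<theta>"
      using cos_ge by (intro mult_mono) auto
    then show ?thesis by (simp only: cos_eq)
  qed
  then have "(\<Sum>n\<in>{N - H<..N}. real N powr (- fi_beta m) / 2) \<le> (\<Sum>n\<in>{N - H<..N}. ?t n)"
    by (rule sum_mono)
  then show ?thesis
    using H unfolding eq by simp
qed

section \<open>Construction of the large values\<close>

text \<open>The chord of the convex function (1 + s)^m over [0, 1] lies above its graph; the
  induction only needs \<open>s * s \<le> s\<close>. It turns a relative error in \<open>u\<close>
  into one of the same order in \<open>u ^ m\<close>.\<close>

lemma one_plus_power_le:
  fixes s :: real
  assumes "0 \<le> s" "s \<le> 1"
  shows "(1 + s) ^ m \<le> 1 + s * (2 ^ m - 1)"
proof (induction m)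
  case (Suc m)
  have "(1 + s) ^ Suc m \<le> (1 + s) * (1 + s * (2 ^ m - 1))"
    using Suc assms by (simp add: mult_left_mono)
  also have "\<dots> = 1 + s + s * (2 ^ m - 1) + s * (s * (2 ^ m - 1))"
    by (simp add: algebra_simps)
  also have "\<dots> \<le> 1 + s + s * (2 ^ m - 1) + 1 * (s * (2 ^ m - 1))"
    using assms by (intro add_left_mono mult_right_mono) auto
  finally show ?case by (simp add: algebra_simps)
qed auto

text \<open>Common source of all the existence claims, which differ only in \<open>a\<close> and
  \<open>lam\<close>. The last exponent is that of block length times weight, 1 - (a + 1) / m -
  \<beta>, and the upper bound on \<open>a\<close> says exactly that it is positive. The sign of
  \<open>r\<close> is recorded so that \<open>x\<close> never drops below
  \<open>lam * N powr a\<close>.\<close>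

lemma dual_sum_large_values:
  fixes a lam :: real
  assumes a: "0 < a" "a < (real m - 3) / 2" and lam: "0 < lam"
  obtains x :: "nat \<Rightarrow> real" and H M :: "nat \<Rightarrow> nat" and r :: "nat \<Rightarrow> real"
  where "\<forall>\<^sub>F N in at_top. 0 < x N \<and> 1 \<le> H N \<and> real (H N) < real N / 2 \<and> M N \<in> {N - H N, N}"
    and "\<forall>\<^sub>F N in at_top. x N = lam * real N powr a * (1 + r N) \<and> 0 \<le> r N"
    and "r \<in> O(\<lambda>N. real N powr (- (a + 1) / real m))"
    and "(\<lambda>N. real (H N)) \<in> \<Theta>(\<lambda>N. real N powr (1 - (a + 1) / real m))"
    and "(\<lambda>N. dual_sum m (x N) (M N)) \<in> \<Omega>(\<lambda>N. real N powr ((real m - 3 - 2 * a) / (2 * real m)))"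
proof -
  have m: "real m > 3" "m \<ge> 1" using a by auto
  define p where "p = (a + 1) / real m"
  have p: "0 < p" "p < 1" using a m by (auto simp: p_def field_simps)
  define L where "L = lam powr (1 / real m)"
  have L: "0 < L" using lam by (simp add: L_def)
  have Lm: "L ^ m = lam" using lam m by (simp add: L_def powr_powr flip: powr_realpow)
  \<comment> \<open>The m-th root of \<open>N * x\<close> for the unperturbed value
    \<open>x = lam * N powr a\<close>.\<close>
  define T where "T = (\<lambda>N::nat. L * real N powr p)"
  define ph where "ph = fi_phi m / (2 * pi)"
  \<comment> \<open>The least value from \<open>T N\<close> upwards that meets the integrality
    condition on the phase. It moves \<open>T N\<close> by at most \<open>1 / m\<close>; rounding up
    rather than down is what makes \<open>r\<close> nonnegative.\<close>
  define u where "u = (\<lambda>N. (of_int \<lceil>real m * T N + ph\<rceil> - ph) / real m)"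
  define x where "x = (\<lambda>N. u N ^ m / real N)"
  \<comment> \<open>Here 12 is twice the 6 of the block condition: \<open>H\<close> is defined
    through \<open>T\<close>, whereas the condition involves \<open>u\<close>, which is at most
    \<open>2 * T\<close> once \<open>T \<ge> 1\<close>.\<close>
  define H where "H = (\<lambda>N. nat \<lfloor>real N / (12 * real m * T N)\<rfloor>)"
  define r where "r = (\<lambda>N. (u N / T N) ^ m - 1)"
  \<comment> \<open>The truncation with the larger absolute value, which is at least half the
    difference of the two sums.\<close>
  define M where "M = (\<lambda>N. if \<bar>dual_sum m (x N) (N - H N)\<bar> \<le> \<bar>dual_sum m (x N) N\<bar>
      then N else N - H N)"
  have T_lim: "filterlim T at_top at_top"
    unfolding T_def using L p by real_asymp
  have NT_lim: "filterlim (\<lambda>N. real N / (12 * real m * T N)) at_top at_top"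
    unfolding T_def using L p m by real_asymp
  have u_ge: "T N \<le> u N" and u_le: "u N \<le> T N + 1 / real m" for N
  proof -
    have "real m * T N / real m \<le> u N" "u N \<le> (real m * T N + 1) / real m"
      unfolding u_def by (intro divide_right_mono; linarith)+
    then show "T N \<le> u N" "u N \<le> T N + 1 / real m"
      using m by (auto simp: add_divide_distrib)
  qed
  have ev: "\<forall>\<^sub>F N in at_top. N > 0 \<and> T N \<ge> 1 \<and> real N / (12 * real m * T N) \<ge> 1"
    using eventually_gt_at_top[of "0::nat"] T_lim NT_lim
    unfolding filterlim_at_top by (auto intro!: eventually_conj)
  have H_bounds: "real (H N) \<le> real N / (12 * real m * T N)"
      "real N / (12 * real m * T N) / 2 \<le> real (H N)" "1 \<le> H N"
    if "real N / (12 * real m * T N) \<ge> 1" for N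
  proof -
    define y where "y = real N / (12 * real m * T N)"
    have y: "1 \<le> y" using that by (simp add: y_def)
    then have H: "real (H N) = of_int \<lfloor>y\<rfloor>" unfolding H_def y_def[symmetric] by simp
    have "1 \<le> \<lfloor>y\<rfloor>" using y by simp
    then have "1 \<le> real (H N)" unfolding H by linarith
    then show "1 \<le> H N" by simp
    \<comment> \<open>Since the floor is at least 1, \<open>y\<close> is less than floor + 1, hence
      at most twice the floor.\<close>
    have "y / 2 \<le> real (H N)" "real (H N) \<le> y"
      using \<open>1 \<le> real (H N)\<close> floor_correct[of y] unfolding H by linarith+
    then show "real (H N) \<le> real N / (12 * real m * T N)"
      "real N / (12 * real m * T N) / 2 \<le> real (H N)"
      unfolding y_def by auto
  qed
  have H_lt: "real (H N) < real N / 2" if "N > 0" "T N \<ge> 1" "real N / (12 * real m * T N) \<ge> 1" for N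
  proof -
    have "12 * real m * T N \<ge> 12 * 1 * 1" using that m by (intro mult_mono) auto
    then have "real N / (12 * real m * T N) \<le> real N / 12"
      by (intro divide_left_mono) auto
    then show ?thesis using H_bounds(1)[OF that(3)] that(1) by linarith
  qed
  have x_eq: "x N = lam * real N powr a * (1 + r N)" if "N > 0" "T N \<ge> 1" for N
  proof -
    have "T N ^ m = lam * real N powr (a + 1)"
      using that m Lm by (simp add: T_def power_mult_distrib p_def powr_powr flip: powr_realpow)
    then have "T N ^ m = lam * real N powr a * real N"
      using that by (simp add: powr_add)
    moreover have "u N ^ m = T N ^ m * (1 + r N)"
      using that by (simp add: r_def power_divide)
    ultimately show ?thesis
      using that by (simp add: x_def)
  qed
  have r_ge: "0 \<le> r N" if "T N \<ge> 1" for N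
    using u_ge[of N] that by (simp add: r_def)
  have r_le: "r N \<le> 2 ^ m / L * real N powr - p" if "N > 0" "T N \<ge> 1" for N
  proof -
    \<comment> \<open>The largest possible relative shift of \<open>T\<close> caused by the
      rounding.\<close>
    define s where "s = 1 / (real m * T N)"
    have "1 * 1 \<le> real m * T N" using m that by (intro mult_mono) auto
    then have s: "0 \<le> s" "s \<le> 1" using that by (auto simp: s_def)
    have "u N / T N \<le> 1 + s"
      using u_le[of N] that m by (simp add: s_def field_simps)
    moreover have "0 \<le> u N / T N" using u_ge[of N] that by simp
    ultimately have "(u N / T N) ^ m \<le> (1 + s) ^ m"
      by (intro power_mono)
    also have "\<dots> \<le> 1 + s * (2 ^ m - 1)"
      by (rule one_plus_power_le[OF s])
    also have "\<dots> \<le> 1 + s * 2 ^ m" using s by (simp add: mult_left_mono)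
    finally have "r N \<le> s * 2 ^ m" by (simp add: r_def)
    also have "s \<le> 1 / T N"
      using that m by (simp add: s_def field_simps)
    then have "s * 2 ^ m \<le> 1 / T N * 2 ^ m" by (intro mult_right_mono) auto
    also have "\<dots> = 2 ^ m / L * real N powr - p"
      by (simp add: T_def powr_minus field_simps)
    finally show ?thesis .
  qed
  define \<delta> where "\<delta> = (real m - 3 - 2 * a) / (2 * real m)"
  have \<delta>: "\<delta> = 1 - p - fi_beta m"
    using m by (simp add: \<delta>_def p_def fi_beta_def field_simps)
  have NT: "real N / (12 * real m * T N) = real N powr (1 - p) / (12 * real m * L)" if "N > 0" for N
    using that by (simp add: T_def powr_diff)
  \<comment> \<open>96 = 12 * 2 * 2 * 2: the 12 in \<open>H\<close>, then a factor 2 each for the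
    floor, for the cosine and for the choice of \<open>M\<close>.\<close>
  have lower: "1 / (96 * real m * L) * real N powr \<delta> \<le> \<bar>dual_sum m (x N) (M N)\<bar>"
    if N: "N > 0" "T N \<ge> 1" "real N / (12 * real m * T N) \<ge> 1" for N
  proof -
    have "real m * u N + fi_phi m / (2 * pi) = of_int \<lceil>real m * T N + ph\<rceil>"
      using m by (simp add: u_def ph_def)
    then have int: "real m * u N + fi_phi m / (2 * pi) \<in> \<int>" by simp
    have "1 / real m \<le> 1" using m by simp
    then have "u N \<le> 2 * T N" using u_le[of N] N by linarith
    then have "6 * real m * u N * real (H N) \<le> 6 * real m * (2 * T N) * real (H N)"
      by (intro mult_right_mono mult_left_mono) auto
    also have "\<dots> \<le> real N"
      using H_bounds(1)[OF N(3)] N m by (simp add: field_simps)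
    finally have short: "6 * real m * u N * real (H N) \<le> real N" .
    have "real N powr \<delta> = real N powr (1 - p) * real N powr (- fi_beta m)"
      unfolding \<delta> by (simp flip: powr_add)
    then have "1 / (96 * real m * L) * real N powr \<delta>
        = (real N powr (1 - p) / (12 * real m * L) / 2) * real N powr (- fi_beta m) / 4"
      by simp
    also have "\<dots> \<le> real (H N) * real N powr (- fi_beta m) / 4"
      using H_bounds(2)[OF N(3)] NT[OF N(1)]
      by (intro divide_right_mono mult_right_mono) auto
    also have "\<dots> \<le> (dual_sum m (x N) N - dual_sum m (x N) (N - H N)) / 2"
      unfolding x_def
      using dual_sum_block_lower[OF m(2) N(1) _ _ int short] H_lt[OF N] u_ge[of N] N by force
    also have "\<dots> \<le> \<bar>dual_sum m (x N) (M N)\<bar>"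
      unfolding M_def by (auto simp: abs_if split: if_splits)
    finally show ?thesis .
  qed
  show thesis
  proof (rule that[of x H M r])
    show "\<forall>\<^sub>F N in at_top. 0 < x N \<and> 1 \<le> H N \<and> real (H N) < real N / 2 \<and> M N \<in> {N - H N, N}"
      using ev
    proof eventually_elim
      case (elim N)
      then have "0 < u N" using u_ge[of N] by linarith
      with elim have "0 < x N" by (simp add: x_def)
      then show ?case using H_lt H_bounds(3) elim by (auto simp: M_def)
    qed
    show "\<forall>\<^sub>F N in at_top. x N = lam * real N powr a * (1 + r N) \<and> 0 \<le> r N"
      using ev by eventually_elim (use x_eq r_ge in blast)
    have neg: "- (a + 1) / real m = - p" unfolding p_def by (rule minus_divide_left[symmetric])
    show "r \<in> O(\<lambda>N. real N powr (- (a + 1) / real m))"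
      unfolding neg
    proof (rule bigoI)
      show "\<forall>\<^sub>F N in at_top. norm (r N) \<le> 2 ^ m / L * norm (real N powr - p)"
        using ev by eventually_elim (use r_le r_ge in force)
    qed
    show "(\<lambda>N. real (H N)) \<in> \<Theta>(\<lambda>N. real N powr (1 - (a + 1) / real m))"
      unfolding p_def[symmetric]
    proof (rule bigthetaI')
      show "\<forall>\<^sub>F N in at_top.
          1 / (24 * real m * L) * norm (real N powr (1 - p)) \<le> norm (real (H N)) \<and>
          norm (real (H N)) \<le> 1 / (12 * real m * L) * norm (real N powr (1 - p))"
        using ev
      proof eventually_elim
        case (elim N)
        then show ?case using H_bounds[of N] NT[of N] by simp
      qed
    qed (use m L in auto)
    show "(\<lambda>N. dual_sum m (x N) (M N))
        \<in> \<Omega>(\<lambda>N. real N powr ((real m - 3 - 2 * a) / (2 * real m)))"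
      unfolding \<delta>_def[symmetric]
    proof (rule landau_omega.bigI)
      show "\<forall>\<^sub>F N in at_top.
          1 / (96 * real m * L) * norm (real N powr \<delta>) \<le> norm (dual_sum m (x N) (M N))"
        using ev by eventually_elim (use lower in auto)
    qed (use m L in auto)
  qed
qed

section \<open>From large values to the failure of the conjectured bound\<close>

lemma perturbation_tendsto_0:
  fixes r :: "nat \<Rightarrow> real"
  assumes "r \<in> O(\<lambda>N. real N powr (- (a + 1) / real m))" "0 < a" "0 < m"
  shows "r \<longlonglongrightarrow> 0"
proof -
  have "((a + 1) / real m) > 0" using assms by simp
  then have "((\<lambda>N. real N powr - ((a + 1) / real m)) \<longlongrightarrow> 0) at_top"
    by real_asymp
  then have "(\<lambda>N. real N powr (- (a + 1) / real m)) \<in> o(\<lambda>_. 1)"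
    unfolding minus_divide_left[symmetric] by (intro smalloI_tendsto) simp_all
  with assms(1) have "r \<in> o(\<lambda>_. 1)" by (rule landau_o.big_small_trans)
  then show ?thesis by (auto dest: smalloD_tendsto)
qed

text \<open>As \<open>M N \<le> N\<close> and \<open>x\<close> is O(N^a), the conjectured bound is
  O(N^((a + 1) \<epsilon>)). Choosing \<open>\<epsilon> = \<delta> / (2 * (a + 1))\<close> makes
  this O(N^(\<delta> / 2)), too small for a function of order at least N^\<delta>.\<close>

lemma conjectured_bound_fails:
  fixes f x :: "nat \<Rightarrow> real" and M :: "nat \<Rightarrow> nat"
  assumes f: "f \<in> \<Omega>(\<lambda>N. real N powr \<delta>)" and \<delta>: "0 < \<delta>"
    and x: "x \<in> O(\<lambda>N. real N powr a)" and a: "0 \<le> a"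
    and M: "\<forall>\<^sub>F N in at_top. M N \<le> N" and x0: "\<forall>\<^sub>F N in at_top. 0 < x N"
  shows "\<exists>\<epsilon>>0. \<not> (\<exists>C. \<forall>\<^sub>F N in at_top. \<bar>f N\<bar> \<le> C * (real (M N) * x N) powr \<epsilon>)"
proof -
  define \<epsilon> where "\<epsilon> = \<delta> / (2 * (a + 1))"
  have \<epsilon>: "0 < \<epsilon>" using \<delta> a by (simp add: \<epsilon>_def)
  have "\<not> (\<forall>\<^sub>F N in at_top. \<bar>f N\<bar> \<le> C * (real (M N) * x N) powr \<epsilon>)" for C
  proof
    assume C: "\<forall>\<^sub>F N in at_top. \<bar>f N\<bar> \<le> C * (real (M N) * x N) powr \<epsilon>"
    obtain c where c: "c > 0" "\<forall>\<^sub>F N in at_top. norm (f N) \<ge> c * norm (real N powr \<delta>)"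
      using f by (elim landau_omega.bigE)
    obtain K where K: "K > 0" "\<forall>\<^sub>F N in at_top. norm (x N) \<le> K * norm (real N powr a)"
      using x by (elim landau_o.bigE)
    have "\<forall>\<^sub>F N in at_top. c * real N powr \<delta> \<le> \<bar>C\<bar> * K powr \<epsilon> * real N powr (\<delta> / 2)"
      using C c(2) K(2) M x0 eventually_gt_at_top[of "0::nat"]
    proof eventually_elim
      case (elim N)
      have "real (M N) * x N \<le> real N * (K * real N powr a)"
        using elim by (intro mult_mono) auto
      also have "\<dots> = K * real N powr (a + 1)"
        using elim by (simp add: powr_add)
      finally have "(real (M N) * x N) powr \<epsilon> \<le> (K * real N powr (a + 1)) powr \<epsilon>"
        using elim \<epsilon> by (intro powr_mono2) auto
      also have "\<dots> = K powr \<epsilon> * real N powr ((a + 1) * \<epsilon>)"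
        using K by (simp add: powr_mult powr_powr)
      also have "(a + 1) * \<epsilon> = \<delta> / 2"
        using a by (simp add: \<epsilon>_def field_simps)
      finally have le: "(real (M N) * x N) powr \<epsilon> \<le> K powr \<epsilon> * real N powr (\<delta> / 2)" .
      have "c * real N powr \<delta> \<le> C * (real (M N) * x N) powr \<epsilon>"
        using elim by simp
      \<comment> \<open>\<open>C\<close> may be negative, so it is replaced by its absolute value
        before the power is enlarged.\<close>
      also have "\<dots> \<le> \<bar>C\<bar> * (real (M N) * x N) powr \<epsilon>"
        by (intro mult_right_mono) auto
      also have "\<dots> \<le> \<bar>C\<bar> * (K powr \<epsilon> * real N powr (\<delta> / 2))"
        using le by (intro mult_left_mono) auto
      finally show ?case by simp
    qed
    then have "(\<lambda>N. real N powr \<delta>) \<in> O(\<lambda>N. real N powr (\<delta> / 2))"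
      using c(1) by (intro bigoI[of _ "\<bar>C\<bar> * K powr \<epsilon> / c"]) (simp add: field_simps)
    moreover have "filterlim real at_top at_top" by (rule filterlim_real_sequentially)
    ultimately have "\<delta> \<le> \<delta> / 2"
      by (simp add: powr_bigo_iff)
    then show False using \<delta> by simp
  qed
  then show ?thesis using \<epsilon> by blast
qed

text \<open>Eventually \<open>1 + r N\<close> lies between 1 / 2 and 2, which supplies both
  constants.\<close>

lemma perturbed_power_bigtheta:
  fixes x r :: "nat \<Rightarrow> real"
  assumes "\<forall>\<^sub>F N in at_top. x N = lam * real N powr a * (1 + r N)" and "r \<longlonglongrightarrow> 0" and "0 < lam"
  shows "x \<in> \<Theta>(\<lambda>N. real N powr a)"
proof -
  have "\<forall>\<^sub>F N in at_top. \<bar>r N\<bar> < 1 / 2"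
    using assms(2)[unfolded tendsto_iff, rule_format, of "1 / 2"] by (simp add: dist_real_def)
  then have "\<forall>\<^sub>F N in at_top. lam / 2 * norm (real N powr a) \<le> norm (x N) \<and>
      norm (x N) \<le> 2 * lam * norm (real N powr a)"
    using assms(1)
  proof eventually_elim
    case (elim N)
    have "lam * real N powr a * (1 / 2) \<le> lam * real N powr a * (1 + r N)"
      "lam * real N powr a * (1 + r N) \<le> lam * real N powr a * 2"
      using elim assms(3) by (intro mult_left_mono; auto simp: abs_if split: if_splits)+
    moreover have "0 \<le> lam * real N powr a * (1 / 2)" using assms(3) by simp
    ultimately show ?case using elim by (auto simp: mult_ac)
  qed
  then show ?thesis
    using assms(3) by (intro bigthetaI'[of "lam / 2" "2 * lam"]) auto
qed

text \<open>The denominator is positive and the numerator is m (m - 4) - 1; for integers, m (m - 4)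
  jumps from at most 0 for m up to 4 to at least 5 from m = 5 on.\<close>

lemma exponent_pos_iff:
  assumes "2 \<le> m"
  shows "0 < ((real m)\<^sup>2 - 4 * real m - 1) / (2 * real m * (real m - 1)) \<longleftrightarrow> 5 \<le> m"
proof -
  have "0 < ((real m)\<^sup>2 - 4 * real m - 1) / (2 * real m * (real m - 1))
      \<longleftrightarrow> 1 < real m * (real m - 4)"
    using assms by (simp add: zero_less_divide_iff power2_eq_square algebra_simps mult_less_0_iff)
  also have "\<dots> \<longleftrightarrow> 5 \<le> m"
  proof
    assume 1: "1 < real m * (real m - 4)"
    show "5 \<le> m"
    proof (rule ccontr)
      assume "\<not> 5 \<le> m"
      then have "real m * (real m - 4) \<le> 0" by (intro mult_nonneg_nonpos) auto
      with 1 show False by simp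
    qed
  next
    assume "5 \<le> m"
    then have "5 * 1 \<le> real m * (real m - 4)" by (intro mult_mono) auto
    then show "1 < real m * (real m - 4)" by simp
  qed
  finally show ?thesis .
qed

section \<open>Specialisation to the individual claims\<close>

theorem corollary1p3:
  shows
    "(\<forall>(m::nat) (a::real). 4 \<le> m \<and> 0 < a \<and> a < (real m - 3) / 2 \<longrightarrow>
       (\<exists>(x :: nat \<Rightarrow> real) (H :: nat \<Rightarrow> nat) (M :: nat \<Rightarrow> nat).
          (\<forall>\<^sub>F N in at_top. 0 < x N \<and> 1 \<le> H N \<and> real (H N) < real N / 2 \<and> M N \<in> {N - H N, N}) \<and>
          x \<in> \<Theta>(\<lambda>N. real N powr a) \<and>
          (\<exists>\<epsilon>>0. \<not> (\<exists>C. \<forall>\<^sub>F N in at_top.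
             \<bar>dual_sum m (x N) (M N)\<bar> \<le> C * (real (M N) * x N) powr \<epsilon>))))
     \<and>
     (\<forall>(m::nat) (lam::real). 6 \<le> m \<and> 1 < lam \<longrightarrow>
       (\<exists>(x :: nat \<Rightarrow> real) (H :: nat \<Rightarrow> nat) (M :: nat \<Rightarrow> nat) (r :: nat \<Rightarrow> real).
          (\<forall>\<^sub>F N in at_top. 0 < x N \<and> 1 \<le> H N \<and> real (H N) < real N / 2 \<and> M N \<in> {N - H N, N} \<and>
             x N = lam * real N * (1 + r N) \<and>
             1 \<le> N - H N \<and> N - H N < N \<and> real N \<le> x N) \<and>
          r \<in> O(\<lambda>N. real N powr (- 2 / real m)) \<and>
          (\<lambda>N. real (H N)) \<in> \<Theta>(\<lambda>N. real N powr (1 - 2 / real m)) \<and>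
          (\<lambda>N. dual_sum m (x N) (M N)) \<in> \<Omega>(\<lambda>N. real N powr ((real m - 5) / (2 * real m)))))
     \<and>
     (\<forall>m::nat. 6 \<le> m \<longrightarrow>
       \<not> (\<forall>\<epsilon>>0. \<exists>C. \<forall>(x::real) (M::nat). 0 < x \<and> 1 \<le> M \<and> real M \<le> x \<longrightarrow>
             \<bar>dual_sum m x M\<bar> \<le> C * (real M * x) powr \<epsilon>))
     \<and>
     (\<forall>(m::nat) (a::real). 5 \<le> m \<and> a = 2 / (real m - 1) \<longrightarrow>
       (\<exists>(x :: nat \<Rightarrow> real) (H :: nat \<Rightarrow> nat) (M :: nat \<Rightarrow> nat) (r :: nat \<Rightarrow> real).
          (\<forall>\<^sub>F N in at_top. 0 < x N \<and> 1 \<le> H N \<and> real (H N) < real N / 2 \<and> M N \<in> {N - H N, N} \<and>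
             x N = real N powr a * (1 + r N)) \<and>
          r \<in> O(\<lambda>N. real N powr (- (a + 1) / real m)) \<and>
          (\<lambda>N. real (H N)) \<in> \<Theta>(\<lambda>N. real N powr (1 - (a + 1) / real m)) \<and>
          (\<lambda>N. real N) \<sim>[at_top] (\<lambda>N. x N powr ((real m - 1) / 2)) \<and>
          (\<lambda>N. dual_sum m (x N) (M N)) \<in>
             \<Omega>(\<lambda>N. real N powr (((real m)\<^sup>2 - 4 * real m - 1) / (2 * real m * (real m - 1))))))
     \<and>
     (\<forall>m::nat. 2 \<le> m \<longrightarrow>
       (0 < ((real m)\<^sup>2 - 4 * real m - 1) / (2 * real m * (real m - 1)) \<longleftrightarrow> 5 \<le> m))"
proof (intro conjI allI impI)
  fix m :: nat and a :: real
  assume ma: "4 \<le> m \<and> 0 < a \<and> a < (real m - 3) / 2"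
  then have a: "0 < a" "a < (real m - 3) / 2" by auto
  obtain x H M r where *:
    "\<forall>\<^sub>F N in at_top. 0 < x N \<and> 1 \<le> H N \<and> real (H N) < real N / 2 \<and> M N \<in> {N - H N, N}"
    "\<forall>\<^sub>F N in at_top. x N = 1 * real N powr a * (1 + r N) \<and> 0 \<le> r N"
    "r \<in> O(\<lambda>N. real N powr (- (a + 1) / real m))"
    "(\<lambda>N. real (H N)) \<in> \<Theta>(\<lambda>N. real N powr (1 - (a + 1) / real m))"
    "(\<lambda>N. dual_sum m (x N) (M N)) \<in> \<Omega>(\<lambda>N. real N powr ((real m - 3 - 2 * a) / (2 * real m)))"
    by (rule dual_sum_large_values[OF a, of 1]) simp_all
  have r0: "r \<longlonglongrightarrow> 0" using perturbation_tendsto_0[OF *(3)] ma by simp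
  have x: "x \<in> \<Theta>(\<lambda>N. real N powr a)"
    by (rule perturbed_power_bigtheta[of x 1 a r]) (use *(2) r0 in \<open>auto elim: eventually_mono\<close>)
  have "\<exists>\<epsilon>>0. \<not> (\<exists>C. \<forall>\<^sub>F N in at_top.
      \<bar>dual_sum m (x N) (M N)\<bar> \<le> C * (real (M N) * x N) powr \<epsilon>)"
  proof (rule conjectured_bound_fails[OF *(5)])
    show "\<forall>\<^sub>F N in at_top. M N \<le> N" "\<forall>\<^sub>F N in at_top. 0 < x N"
      using *(1) by (auto elim!: eventually_mono)
  qed (use ma x in auto)
  with *(1) x show "\<exists>(x :: nat \<Rightarrow> real) (H :: nat \<Rightarrow> nat) (M :: nat \<Rightarrow> nat).
          (\<forall>\<^sub>F N in at_top. 0 < x N \<and> 1 \<le> H N \<and> real (H N) < real N / 2 \<and> M N \<in> {N - H N, N}) \<and>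
          x \<in> \<Theta>(\<lambda>N. real N powr a) \<and>
          (\<exists>\<epsilon>>0. \<not> (\<exists>C. \<forall>\<^sub>F N in at_top.
             \<bar>dual_sum m (x N) (M N)\<bar> \<le> C * (real (M N) * x N) powr \<epsilon>))"
    by blast
next
  fix m :: nat and lam :: real
  assume ml: "6 \<le> m \<and> 1 < lam"
  \<comment> \<open>The instance \<open>a = 1\<close>, for which the admissibility condition reads m
    > 5.\<close>
  then have a: "(0::real) < 1" "1 < (real m - 3) / 2" "0 < lam" by auto
  obtain x H M r where *:
    "\<forall>\<^sub>F N in at_top. 0 < x N \<and> 1 \<le> H N \<and> real (H N) < real N / 2 \<and> M N \<in> {N - H N, N}"
    "\<forall>\<^sub>F N in at_top. x N = lam * real N powr 1 * (1 + r N) \<and> 0 \<le> r N"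
    "r \<in> O(\<lambda>N. real N powr (- (1 + 1) / real m))"
    "(\<lambda>N. real (H N)) \<in> \<Theta>(\<lambda>N. real N powr (1 - (1 + 1) / real m))"
    "(\<lambda>N. dual_sum m (x N) (M N)) \<in> \<Omega>(\<lambda>N. real N powr ((real m - 3 - 2 * 1) / (2 * real m)))"
    by (rule dual_sum_large_values[OF a])
  have "\<forall>\<^sub>F N in at_top. 0 < x N \<and> 1 \<le> H N \<and> real (H N) < real N / 2 \<and> M N \<in> {N - H N, N} \<and>
             x N = lam * real N * (1 + r N) \<and>
             1 \<le> N - H N \<and> N - H N < N \<and> real N \<le> x N"
    using *(1,2)
  proof eventually_elim
    case (elim N)
    \<comment> \<open>Both \<open>lam > 1\<close> and \<open>r N \<ge> 0\<close> enter here: they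
      keep the perturbed \<open>x N\<close> in the range \<open>N \<le> x N\<close>.\<close>
    have "1 * real N * 1 \<le> lam * real N * (1 + r N)"
      using elim ml by (intro mult_mono) auto
    moreover have "x N = lam * real N * (1 + r N)" using elim by simp
    ultimately show ?case using elim by auto
  qed
  then show "\<exists>(x :: nat \<Rightarrow> real) (H :: nat \<Rightarrow> nat) (M :: nat \<Rightarrow> nat) (r :: nat \<Rightarrow> real).
          (\<forall>\<^sub>F N in at_top. 0 < x N \<and> 1 \<le> H N \<and> real (H N) < real N / 2 \<and> M N \<in> {N - H N, N} \<and>
             x N = lam * real N * (1 + r N) \<and>
             1 \<le> N - H N \<and> N - H N < N \<and> real N \<le> x N) \<and>
          r \<in> O(\<lambda>N. real N powr (- 2 / real m)) \<and>
          (\<lambda>N. real (H N)) \<in> \<Theta>(\<lambda>N. real N powr (1 - 2 / real m)) \<and>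
          (\<lambda>N. dual_sum m (x N) (M N)) \<in> \<Omega>(\<lambda>N. real N powr ((real m - 5) / (2 * real m)))"
    using *(3-5) by (intro exI[of _ x] exI[of _ H] exI[of _ M] exI[of _ r]) simp
next
  fix m :: nat
  assume m: "6 \<le> m"
  then have a: "(0::real) < 1" "1 < (real m - 3) / 2" by auto
  obtain x H M r where *:
    "\<forall>\<^sub>F N in at_top. 0 < x N \<and> 1 \<le> H N \<and> real (H N) < real N / 2 \<and> M N \<in> {N - H N, N}"
    "\<forall>\<^sub>F N in at_top. x N = 2 * real N powr 1 * (1 + r N) \<and> 0 \<le> r N"
    "r \<in> O(\<lambda>N. real N powr (- (1 + 1) / real m))"
    "(\<lambda>N. real (H N)) \<in> \<Theta>(\<lambda>N. real N powr (1 - (1 + 1) / real m))"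
    "(\<lambda>N. dual_sum m (x N) (M N)) \<in> \<Omega>(\<lambda>N. real N powr ((real m - 3 - 2 * 1) / (2 * real m)))"
    \<comment> \<open>One fixed \<open>lam > 1\<close> suffices to refute a bound claimed for the
      whole range; 2 is such a value.\<close>
    by (rule dual_sum_large_values[OF a, of 2]) simp_all
  have r0: "r \<longlonglongrightarrow> 0" using perturbation_tendsto_0[OF *(3)] m by simp
  have x: "x \<in> \<Theta>(\<lambda>N. real N powr 1)"
    by (rule perturbed_power_bigtheta[of x 2 1 r]) (use *(2) r0 in \<open>auto elim: eventually_mono\<close>)
  have "\<exists>\<epsilon>>0. \<not> (\<exists>C. \<forall>\<^sub>F N in at_top.
      \<bar>dual_sum m (x N) (M N)\<bar> \<le> C * (real (M N) * x N) powr \<epsilon>)"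
  proof (rule conjectured_bound_fails[OF *(5), where a = 1])
    show "\<forall>\<^sub>F N in at_top. M N \<le> N" "\<forall>\<^sub>F N in at_top. 0 < x N"
      using *(1) by (auto elim!: eventually_mono)
  qed (use m bigthetaD1[OF x] in simp_all)
  then obtain \<epsilon> where \<epsilon>: "\<epsilon> > 0" "\<And>C. \<not> (\<forall>\<^sub>F N in at_top.
      \<bar>dual_sum m (x N) (M N)\<bar> \<le> C * (real (M N) * x N) powr \<epsilon>)"
    by blast
  \<comment> \<open>Places the sequence inside the restricted range, so a constant uniform there
    would serve along the sequence. \<open>M N \<ge> 1\<close> follows from
    \<open>H N < N / 2\<close>.\<close>
  have range: "\<forall>\<^sub>F N in at_top. 0 < x N \<and> 1 \<le> M N \<and> real (M N) \<le> x N"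
    using *(1,2)
  proof eventually_elim
    case (elim N)
    have "1 * real N * 1 \<le> 2 * real N * (1 + r N)"
      using elim by (intro mult_mono) auto
    then have "real N \<le> x N" using elim by simp
    then show ?case using elim(1) by auto
  qed
  show "\<not> (\<forall>\<epsilon>>0. \<exists>C. \<forall>(x::real) (M::nat). 0 < x \<and> 1 \<le> M \<and> real M \<le> x \<longrightarrow>
             \<bar>dual_sum m x M\<bar> \<le> C * (real M * x) powr \<epsilon>)"
  proof
    assume "\<forall>\<epsilon>>0. \<exists>C. \<forall>(x::real) (M::nat). 0 < x \<and> 1 \<le> M \<and> real M \<le> x \<longrightarrow>
             \<bar>dual_sum m x M\<bar> \<le> C * (real M * x) powr \<epsilon>"
    then obtain C where "\<And>(x::real) (M::nat). 0 < x \<and> 1 \<le> M \<and> real M \<le> x \<Longrightarrow>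
             \<bar>dual_sum m x M\<bar> \<le> C * (real M * x) powr \<epsilon>"
      using \<epsilon>(1) by blast
    with range have "\<forall>\<^sub>F N in at_top.
        \<bar>dual_sum m (x N) (M N)\<bar> \<le> C * (real (M N) * x N) powr \<epsilon>"
      by (auto elim: eventually_mono)
    with \<epsilon>(2) show False by blast
  qed
next
  fix m :: nat and a :: real
  assume ma: "5 \<le> m \<and> a = 2 / (real m - 1)"
  have a_pos: "0 < a" using ma by simp
  have am: "a * (real m - 1) = 2" using ma by (simp add: field_simps)
  \<comment> \<open>For \<open>m \<ge> 5\<close> the value 1 / 2 already separates \<open>a\<close>
    from \<open>(m - 3) / 2 \<ge> 1\<close>.\<close>
  have "a \<le> 1 / 2" using ma by (simp add: field_simps)
  moreover have "1 \<le> (real m - 3) / 2" using ma by simp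
  ultimately have a_less: "a < (real m - 3) / 2" by linarith
  obtain x H M r where *:
    "\<forall>\<^sub>F N in at_top. 0 < x N \<and> 1 \<le> H N \<and> real (H N) < real N / 2 \<and> M N \<in> {N - H N, N}"
    "\<forall>\<^sub>F N in at_top. x N = 1 * real N powr a * (1 + r N) \<and> 0 \<le> r N"
    "r \<in> O(\<lambda>N. real N powr (- (a + 1) / real m))"
    "(\<lambda>N. real (H N)) \<in> \<Theta>(\<lambda>N. real N powr (1 - (a + 1) / real m))"
    "(\<lambda>N. dual_sum m (x N) (M N)) \<in> \<Omega>(\<lambda>N. real N powr ((real m - 3 - 2 * a) / (2 * real m)))"
    by (rule dual_sum_large_values[OF a_pos a_less, of 1]) simp_all
  have r0: "r \<longlonglongrightarrow> 0" using perturbation_tendsto_0[OF *(3) a_pos] ma by simp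
  have expo: "(real m - 3 - 2 * a) / (2 * real m)
      = ((real m)\<^sup>2 - 4 * real m - 1) / (2 * real m * (real m - 1))"
  proof -
    \<comment> \<open>Since a (m - 1) = 2, the left side is (m - 3) (m - 1) - 4.\<close>
    have "(real m - 3 - 2 * a) * (real m - 1) = (real m)\<^sup>2 - 4 * real m - 1"
      using am by (simp add: power2_eq_square algebra_simps)
    then show ?thesis using ma by (simp add: frac_eq_eq)
  qed
  \<comment> \<open>The exponent a (m - 1) / 2 equals 1, so the quotient of the two sides is (1 +
    r)^((m - 1) / 2), which tends to 1.\<close>
  have "(\<lambda>N. x N powr ((real m - 1) / 2)) \<sim>[at_top] (\<lambda>N. real N)"
  proof (rule asymp_equivI')
    have "(\<lambda>N. (1 + r N) powr ((real m - 1) / 2)) \<longlonglongrightarrow> (1 + 0) powr ((real m - 1) / 2)"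
      using r0 by (intro tendsto_intros) auto
    then have "(\<lambda>N. (1 + r N) powr ((real m - 1) / 2)) \<longlonglongrightarrow> 1" by simp
    moreover have "\<forall>\<^sub>F N in at_top.
        (1 + r N) powr ((real m - 1) / 2) = x N powr ((real m - 1) / 2) / real N"
      using *(2) eventually_gt_at_top[of "0::nat"]
      by eventually_elim (simp add: powr_mult powr_powr am)
    ultimately show "(\<lambda>N. x N powr ((real m - 1) / 2) / real N) \<longlonglongrightarrow> 1"
      by (rule Lim_transform_eventually)
  qed
  then have equiv: "(\<lambda>N. real N) \<sim>[at_top] (\<lambda>N. x N powr ((real m - 1) / 2))"
    by (simp add: asymp_equiv_sym)
  have "\<forall>\<^sub>F N in at_top. 0 < x N \<and> 1 \<le> H N \<and> real (H N) < real N / 2 \<and> M N \<in> {N - H N, N} \<and>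
             x N = real N powr a * (1 + r N)"
    using *(1,2) by eventually_elim simp
  then show "\<exists>(x :: nat \<Rightarrow> real) (H :: nat \<Rightarrow> nat) (M :: nat \<Rightarrow> nat) (r :: nat \<Rightarrow> real).
          (\<forall>\<^sub>F N in at_top. 0 < x N \<and> 1 \<le> H N \<and> real (H N) < real N / 2 \<and> M N \<in> {N - H N, N} \<and>
             x N = real N powr a * (1 + r N)) \<and>
          r \<in> O(\<lambda>N. real N powr (- (a + 1) / real m)) \<and>
          (\<lambda>N. real (H N)) \<in> \<Theta>(\<lambda>N. real N powr (1 - (a + 1) / real m)) \<and>
          (\<lambda>N. real N) \<sim>[at_top] (\<lambda>N. x N powr ((real m - 1) / 2)) \<and>
          (\<lambda>N. dual_sum m (x N) (M N)) \<in>
             \<Omega>(\<lambda>N. real N powr (((real m)\<^sup>2 - 4 * real m - 1) / (2 * real m * (real m - 1))))"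
    using *(3-5) equiv unfolding expo by blast
qed (rule exponent_pos_iff)

end
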